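(* Let $\nabla$ be a connection on $M$ (i.e. on the tangent bundle $TM$). (a) $\nabla^2f$ is symmetric for all $f\in\mathcal F(M)$ if and only if $\nabla$ has torsion zero. (b) $\nabla^2f$ and $\nabla^3f$ are both symmetric for all $f\in\mathcal F(M)$ if and only if $\nabla$ has both torsion and curvature zero. (c) If $\nabla$ has torsion and curvature zero, then $\nabla^nf$ is symmetric for all $n\ge 2$ and all $f\in\mathcal F(M)$.
   Context: $M$ is a Hausdorff, paracompact, smooth finite-dimensional manifold; $\mathcal F(M)$ is the space of smooth real-valued functions on $M$; $\Omega^n(M)$ is the space of smooth covariant tensor fields of order $n$ on $M$. A connection on $M$ is a Koszul connection $\nabla$ on $TM$. For $\omega\in\Omega^n(M)$, $\nabla\omega\in\Omega^{n+1}(M)$ is defined by $\nabla\omega(X_0,\dots,X_n)=X_0\cdot(\omega(X_1,\dots,X_n))-\sum_{i=1}^n\omega(X_1,\dots,\nabla_{X_0}X_i,\dots,X_n)$. For $f\in\mathcal F(M)$, $\nabla^1f=\nabla f=df$ and $\nabla^{n+1}f=\nabla(\nabla^nf)$. The torsion and curvature are $T(X,Y)=\nabla_XY-\nabla_YX-[X,Y]$ and $R(X,Y)Z=\nabla_X\nabla_YZ-\nabla_Y\nabla_XZ-\nabla_{[X,Y]}Z$. A covariant tensor is symmetric if it is invariant under all permutations of its arguments. *)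

theory Defs
  imports "HOL-Analysis.Analysis" "HOL-Combinatorics.Permutations"
begin

section \<open>Smooth functions on open subsets of \<open>\<real>\<^sup>n\<close>\<close>

text \<open>
  The model space \<open>\<real>\<^sup>n\<close> is the library's \<^const>\<open>Euclidean_space\<close> \<open>n\<close>, so the dimension is a
  natural number (possibly 0). The predicates below are meant for sets \<open>S\<close> that are open in
  \<open>\<real>\<^sup>n\<close>; they then depend only on the values of \<open>f\<close> on \<open>S\<close>.
\<close>

definition partial_deriv :: "nat \<Rightarrow> ((nat \<Rightarrow> real) \<Rightarrow> real) \<Rightarrow> (nat \<Rightarrow> real) \<Rightarrow> real" where
  "partial_deriv i f x = deriv (\<lambda>t. f (x(i := t))) (x i)"

primrec Ck_on :: "nat \<Rightarrow> nat \<Rightarrow> (nat \<Rightarrow> real) set \<Rightarrow> ((nat \<Rightarrow> real) \<Rightarrow> real) \<Rightarrow> bool" where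
  "Ck_on n 0 S f \<longleftrightarrow> continuous_map (subtopology (Euclidean_space n) S) euclideanreal f"
| "Ck_on n (Suc k) S f \<longleftrightarrow>
     continuous_map (subtopology (Euclidean_space n) S) euclideanreal f \<and>
     (\<forall>i<n. (\<forall>x\<in>S. (\<lambda>t. f (x(i := t))) differentiable at (x i)) \<and>
            Ck_on n k S (partial_deriv i f))"

definition Cinf_on :: "nat \<Rightarrow> (nat \<Rightarrow> real) set \<Rightarrow> ((nat \<Rightarrow> real) \<Rightarrow> real) \<Rightarrow> bool" where
  "Cinf_on n S f \<longleftrightarrow> (\<forall>k. Ck_on n k S f)"

section \<open>Smooth manifolds\<close>

definition paracompact_space :: "'a topology \<Rightarrow> bool" where
  "paracompact_space X \<longleftrightarrow>
     (\<forall>\<U>. (\<forall>U\<in>\<U>. openin X U) \<and> \<Union>\<U> = topspace X \<longrightarrow>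
        (\<exists>\<V>. (\<forall>V\<in>\<V>. openin X V \<and> (\<exists>U\<in>\<U>. V \<subseteq> U)) \<and> \<Union>\<V> = topspace X \<and>
             locally_finite_in X \<V>))"

text \<open>The points of the manifold are those of \<open>topspace (mfd_top M)\<close>; a chart is a pair
  \<open>(U, \<phi>)\<close> of its domain and its coordinate map, the latter being arbitrary outside \<open>U\<close>.\<close>

record 'a manifold =
  mfd_dim :: nat
  mfd_top :: "'a topology"
  mfd_atlas :: "('a set \<times> ('a \<Rightarrow> nat \<Rightarrow> real)) set"

definition pts :: "'a manifold \<Rightarrow> 'a set" where
  "pts M = topspace (mfd_top M)"

definition is_chart :: "nat \<Rightarrow> 'a topology \<Rightarrow> 'a set \<Rightarrow> ('a \<Rightarrow> nat \<Rightarrow> real) \<Rightarrow> bool" where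
  "is_chart n X U \<phi> \<longleftrightarrow>
     openin X U \<and> openin (Euclidean_space n) (\<phi> ` U) \<and>
     homeomorphic_map (subtopology X U) (subtopology (Euclidean_space n) (\<phi> ` U)) \<phi>"

definition smooth_manifold :: "'a manifold \<Rightarrow> bool" where
  "smooth_manifold M \<longleftrightarrow>
     Hausdorff_space (mfd_top M) \<and> paracompact_space (mfd_top M) \<and>
     (\<forall>(U, \<phi>)\<in>mfd_atlas M. is_chart (mfd_dim M) (mfd_top M) U \<phi>) \<and>
     (\<Union>(U, \<phi>)\<in>mfd_atlas M. U) = pts M \<and>
     (\<forall>(U, \<phi>)\<in>mfd_atlas M. \<forall>(V, \<psi>)\<in>mfd_atlas M. \<forall>i<mfd_dim M.
        Cinf_on (mfd_dim M) (\<phi> ` (U \<inter> V)) (\<lambda>x. \<psi> (inv_into U \<phi> x) i))"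

text \<open>
  \<open>\<F>(M)\<close>. Throughout, objects living on \<open>M\<close> are extended by zero off their domain, so that
  equality in HOL is equality on \<open>M\<close>.
\<close>

definition smooth_functions :: "'a manifold \<Rightarrow> ('a \<Rightarrow> real) set" where
  "smooth_functions M =
     {f. (\<forall>(U, \<phi>)\<in>mfd_atlas M. Cinf_on (mfd_dim M) (\<phi> ` U) (\<lambda>x. f (inv_into U \<phi> x))) \<and>
         (\<forall>p. p \<notin> pts M \<longrightarrow> f p = 0)}"

section \<open>Tangent vectors and vector fields\<close>

text \<open>
  As in O'Neill's Semi-Riemannian Geometry: a tangent vector at \<open>p\<close> is an \<open>\<real>\<close>-linear,
  Leibnizian functional on \<open>\<F>(M)\<close>, and a vector field \<open>X\<close>, assigning to each \<open>p\<close> a tangent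
  vector \<open>X\<^sub>p\<close>, is smooth if \<open>p \<mapsto> X\<^sub>p f\<close> is in \<open>\<F>(M)\<close> for every \<open>f\<close> in \<open>\<F>(M)\<close>.
\<close>

definition tangent_space :: "'a manifold \<Rightarrow> 'a \<Rightarrow> (('a \<Rightarrow> real) \<Rightarrow> real) set" where
  "tangent_space M p =
     {v. (\<forall>f\<in>smooth_functions M. \<forall>g\<in>smooth_functions M.
            v (\<lambda>q. f q + g q) = v f + v g \<and>
            v (\<lambda>q. f q * g q) = v f * g p + f p * v g) \<and>
         (\<forall>f\<in>smooth_functions M. \<forall>c. v (\<lambda>q. c * f q) = c * v f) \<and>
         (\<forall>f. f \<notin> smooth_functions M \<longrightarrow> v f = 0)}"

type_synonym 'a vfield = "'a \<Rightarrow> ('a \<Rightarrow> real) \<Rightarrow> real"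

definition vact :: "'a vfield \<Rightarrow> ('a \<Rightarrow> real) \<Rightarrow> 'a \<Rightarrow> real" where
  "vact X f = (\<lambda>p. X p f)"

definition vector_fields :: "'a manifold \<Rightarrow> 'a vfield set" where
  "vector_fields M =
     {X. (\<forall>p\<in>pts M. X p \<in> tangent_space M p) \<and>
         (\<forall>p. p \<notin> pts M \<longrightarrow> X p = (\<lambda>f. 0)) \<and>
         (\<forall>f\<in>smooth_functions M. vact X f \<in> smooth_functions M)}"

definition vzero :: "'a vfield" where
  "vzero = (\<lambda>p f. 0)"

definition vadd :: "'a vfield \<Rightarrow> 'a vfield \<Rightarrow> 'a vfield" where
  "vadd X Y = (\<lambda>p f. X p f + Y p f)"

definition vminus :: "'a vfield \<Rightarrow> 'a vfield \<Rightarrow> 'a vfield" where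
  "vminus X Y = (\<lambda>p f. X p f - Y p f)"

definition vscale :: "('a \<Rightarrow> real) \<Rightarrow> 'a vfield \<Rightarrow> 'a vfield" where
  "vscale h X = (\<lambda>p f. h p * X p f)"

definition lie_bracket :: "'a vfield \<Rightarrow> 'a vfield \<Rightarrow> 'a vfield" where
  "lie_bracket X Y = (\<lambda>p f. X p (vact Y f) - Y p (vact X f))"

section \<open>Connections\<close>

text \<open>Koszul connections on the tangent bundle; \<open>D X Y\<close> is \<open>\<nabla>\<^sub>X Y\<close>. Nothing is required of \<open>D\<close>
  on arguments that are not smooth vector fields.\<close>

definition connection :: "'a manifold \<Rightarrow> ('a vfield \<Rightarrow> 'a vfield \<Rightarrow> 'a vfield) \<Rightarrow> bool" where
  "connection M D \<longleftrightarrow>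
     (\<forall>X\<in>vector_fields M. \<forall>Y\<in>vector_fields M. D X Y \<in> vector_fields M) \<and>
     (\<forall>X\<in>vector_fields M. \<forall>X'\<in>vector_fields M. \<forall>Y\<in>vector_fields M.
        D (vadd X X') Y = vadd (D X Y) (D X' Y)) \<and>
     (\<forall>h\<in>smooth_functions M. \<forall>X\<in>vector_fields M. \<forall>Y\<in>vector_fields M.
        D (vscale h X) Y = vscale h (D X Y)) \<and>
     (\<forall>X\<in>vector_fields M. \<forall>Y\<in>vector_fields M. \<forall>Y'\<in>vector_fields M.
        D X (vadd Y Y') = vadd (D X Y) (D X Y')) \<and>
     (\<forall>c. \<forall>X\<in>vector_fields M. \<forall>Y\<in>vector_fields M.
        D X (vscale (\<lambda>p. c) Y) = vscale (\<lambda>p. c) (D X Y)) \<and>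
     (\<forall>h\<in>smooth_functions M. \<forall>X\<in>vector_fields M. \<forall>Y\<in>vector_fields M.
        D X (vscale h Y) = vadd (vscale (vact X h) Y) (vscale h (D X Y)))"

definition torsion ::
    "('a vfield \<Rightarrow> 'a vfield \<Rightarrow> 'a vfield) \<Rightarrow> 'a vfield \<Rightarrow> 'a vfield \<Rightarrow> 'a vfield" where
  "torsion D X Y = vminus (vminus (D X Y) (D Y X)) (lie_bracket X Y)"

definition curvature ::
    "('a vfield \<Rightarrow> 'a vfield \<Rightarrow> 'a vfield) \<Rightarrow> 'a vfield \<Rightarrow> 'a vfield \<Rightarrow> 'a vfield \<Rightarrow> 'a vfield" where
  "curvature D X Y Z =
     vminus (vminus (D X (D Y Z)) (D Y (D X Z))) (D (lie_bracket X Y) Z)"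

definition torsion_zero ::
    "'a manifold \<Rightarrow> ('a vfield \<Rightarrow> 'a vfield \<Rightarrow> 'a vfield) \<Rightarrow> bool" where
  "torsion_zero M D \<longleftrightarrow>
     (\<forall>X\<in>vector_fields M. \<forall>Y\<in>vector_fields M. torsion D X Y = vzero)"

definition curvature_zero ::
    "'a manifold \<Rightarrow> ('a vfield \<Rightarrow> 'a vfield \<Rightarrow> 'a vfield) \<Rightarrow> bool" where
  "curvature_zero M D \<longleftrightarrow>
     (\<forall>X\<in>vector_fields M. \<forall>Y\<in>vector_fields M. \<forall>Z\<in>vector_fields M. curvature D X Y Z = vzero)"

section \<open>Covariant tensor fields and iterated covariant derivatives\<close>

text \<open>
  \<open>\<Omega>\<^sup>n(M)\<close>: \<open>\<F>(M)\<close>-multilinear maps from \<open>n\<close>-tuples of smooth vector fields to \<open>\<F>(M)\<close>. The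
  arguments are given as a list; values on lists that are not \<open>n\<close>-tuples of smooth vector
  fields are irrelevant.
\<close>

type_synonym 'a tensor = "'a vfield list \<Rightarrow> 'a \<Rightarrow> real"

definition vf_tuples :: "'a manifold \<Rightarrow> nat \<Rightarrow> 'a vfield list set" where
  "vf_tuples M n = {Xs. length Xs = n \<and> set Xs \<subseteq> vector_fields M}"

definition covariant_tensors :: "'a manifold \<Rightarrow> nat \<Rightarrow> 'a tensor set" where
  "covariant_tensors M n =
     {\<omega>. (\<forall>Xs\<in>vf_tuples M n. \<omega> Xs \<in> smooth_functions M) \<and>
         (\<forall>Xs\<in>vf_tuples M n. \<forall>i<n. \<forall>Y\<in>vector_fields M. \<forall>Z\<in>vector_fields M.
            \<omega> (Xs[i := vadd Y Z]) = (\<lambda>p. \<omega> (Xs[i := Y]) p + \<omega> (Xs[i := Z]) p)) \<and>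
         (\<forall>Xs\<in>vf_tuples M n. \<forall>i<n. \<forall>h\<in>smooth_functions M. \<forall>Y\<in>vector_fields M.
            \<omega> (Xs[i := vscale h Y]) = (\<lambda>p. h p * \<omega> (Xs[i := Y]) p))}"

definition symmetric_tensor :: "'a manifold \<Rightarrow> nat \<Rightarrow> 'a tensor \<Rightarrow> bool" where
  "symmetric_tensor M n \<omega> \<longleftrightarrow>
     \<omega> \<in> covariant_tensors M n \<and>
     (\<forall>\<sigma>. \<sigma> permutes {..<n} \<longrightarrow> (\<forall>Xs\<in>vf_tuples M n. \<omega> (permute_list \<sigma> Xs) = \<omega> Xs))"

text \<open>The head of the argument list is the direction \<open>X\<^sub>0\<close> of differentiation.\<close>

definition cov_deriv ::
    "('a vfield \<Rightarrow> 'a vfield \<Rightarrow> 'a vfield) \<Rightarrow> 'a tensor \<Rightarrow> 'a tensor" where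
  "cov_deriv D \<omega> Xs = (\<lambda>p. vact (hd Xs) (\<omega> (tl Xs)) p -
     (\<Sum>i<length (tl Xs). \<omega> ((tl Xs)[i := D (hd Xs) (tl Xs ! i)]) p))"

text \<open>\<open>\<nabla>\<^sup>n f\<close>, starting from \<open>f\<close> viewed as a tensor of order 0.\<close>

primrec cov_deriv_pow ::
    "('a vfield \<Rightarrow> 'a vfield \<Rightarrow> 'a vfield) \<Rightarrow> nat \<Rightarrow> ('a \<Rightarrow> real) \<Rightarrow> 'a tensor" where
  "cov_deriv_pow D 0 f = (\<lambda>Xs. f)"
| "cov_deriv_pow D (Suc n) f = cov_deriv D (cov_deriv_pow D n f)"

lemma cov_deriv_pow_1: "cov_deriv_pow D 1 f [X] = vact X f"
  by (simp add: cov_deriv_def vact_def)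

lemma cov_deriv_pow_2: "cov_deriv_pow D 2 f [X, Y] p = X p (vact Y f) - D X Y p f"
  by (simp add: cov_deriv_def vact_def numeral_2_eq_2)

end

theory Submission
  imports Defs
begin

text \<open>
  Every covariant tensor \<open>\<omega>\<close> satisfies the Ricci identity
  \<open>\<nabla>\<^sup>2\<omega>(X,Y,Z\<^sub>1,\<dots>) - \<nabla>\<^sup>2\<omega>(Y,X,Z\<^sub>1,\<dots>) = -\<nabla>\<omega>(T(X,Y),Z\<^sub>1,\<dots>) - \<Sum>\<^sub>i \<omega>(\<dots>,R(X,Y)Z\<^sub>i,\<dots>)\<close>.
  For \<open>\<omega> = f\<close> it says that the defect of symmetry of \<open>\<nabla>\<^sup>2f\<close> is \<open>-T(X,Y)f\<close>; for \<open>\<omega> = df\<close> and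
  \<open>T = 0\<close>, that the obstruction to exchanging the first two arguments of \<open>\<nabla>\<^sup>3f\<close> is \<open>-(R(X,Y)Z)f\<close>.
  A vector field that annihilates all smooth functions is zero. If \<open>T\<close> and \<open>R\<close> vanish, the first two
  arguments of every \<open>\<nabla>\<^sup>nf\<close> may be exchanged, and inductively the arguments after the first may be
  permuted; these exchanges generate all permutations.
\<close>

section \<open>Smooth functions\<close>

text \<open>A partial derivative is taken along a coordinate line. Near its base point this line
  stays in the open set, so values outside \<open>S\<close> cannot influence the derivative.\<close>

lemma eventually_fun_upd_in_openin_Euclidean_space:
  assumes S: "openin (Euclidean_space n) S" and x: "x \<in> S" and i: "i < n"
  shows "\<forall>\<^sub>F t in nhds (x i). x(i := t) \<in> S"
proof -
  \<comment> \<open>Points of \<open>Euclidean_space n\<close> vanish from coordinate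
    \<open>n\<close> on; changing a coordinate \<open>i < n\<close> preserves this.\<close>
  have x0: "x j = 0" if "j \<ge> n" for j
    using openin_subset[OF S] x that by (auto simp: topspace_Euclidean_space)
  have "continuous_map euclideanreal (Euclidean_space n) (\<lambda>t. x(i := t))"
    unfolding Euclidean_space_def continuous_map_in_subtopology continuous_map_componentwise_UNIV
    using x0 i by (auto simp: fun_upd_def)
  then have "open {t. x(i := t) \<in> S}"
    using openin_continuous_map_preimage[OF _ S] by fastforce
  then show ?thesis
    using x by (auto simp: eventually_nhds intro!: exI[of _ "{t. x(i := t) \<in> S}"])
qed

lemma has_real_derivative_partial_deriv:
  assumes "Ck_on n (Suc k) S f" "x \<in> S" "i < n"
  shows "((\<lambda>t. f (x(i := t))) has_real_derivative partial_deriv i f x) (at (x i))"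
  using assms by (simp add: partial_deriv_def DERIV_deriv_iff_real_differentiable)

text \<open>Coordinate lines stay in \<open>S\<close> for a while, so agreement on \<open>S\<close>
  passes to the partial derivatives, and the induction can go on with those. This allows replacing
  \<open>partial_deriv i\<close> of a sum or product by the usual formula, which is known only on
  \<open>S\<close>.\<close>

lemma Ck_on_cong:
  assumes S: "openin (Euclidean_space n) S"
  shows "(\<And>x. x \<in> S \<Longrightarrow> f x = g x) \<Longrightarrow> Ck_on n k S f \<Longrightarrow> Ck_on n k S g"
proof (induction k arbitrary: f g)
  case 0
  then show ?case
    by (auto elim!: continuous_map_eq)
next
  case (Suc k)
  have ev: "\<forall>\<^sub>F t in nhds (x i). f (x(i := t)) = g (x(i := t))" if "x \<in> S" "i < n" for x i
    using eventually_fun_upd_in_openin_Euclidean_space[OF S that]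
    by eventually_elim (use Suc.prems in auto)
  have pd: "partial_deriv i f x = partial_deriv i g x" if "x \<in> S" "i < n" for x i
    unfolding partial_deriv_def by (intro deriv_cong_ev ev that refl)
  have "Ck_on n k S (partial_deriv i g)" if "i < n" for i
  proof (rule Suc.IH)
    show "Ck_on n k S (partial_deriv i f)"
      using Suc.prems(2) that unfolding Ck_on.simps by blast
  qed (rule pd[OF _ that])
  moreover have "(\<lambda>t. g (x(i := t))) differentiable at (x i)" if "x \<in> S" "i < n" for x i
  proof -
    have "((\<lambda>t. g (x(i := t))) has_real_derivative partial_deriv i f x) (at (x i))"
      using has_real_derivative_partial_deriv[OF Suc.prems(2) that]
        DERIV_cong_ev[OF refl ev[OF that] refl] by blast
    then show ?thesis
      by (auto simp: real_differentiable_def)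
  qed
  moreover have "continuous_map (subtopology (Euclidean_space n) S) euclideanreal g"
    by (rule continuous_map_eq[of _ _ f]) (use Suc.prems in simp_all)
  ultimately show ?case
    by simp
qed

lemma Ck_on_SucD: "Ck_on n (Suc k) S f \<Longrightarrow> Ck_on n k S f"
proof (induction k arbitrary: f)
  case (Suc k)
  then show ?case
    unfolding Ck_on.simps(2)[of n "Suc k"] Ck_on.simps(2)[of n k S f] by blast
qed simp

lemma Ck_on_const: "Ck_on n k S (\<lambda>x. c)"
proof (induction k arbitrary: c)
  case (Suc k)
  have "partial_deriv i (\<lambda>x. c) = (\<lambda>x. 0)" for i
    by (auto simp: partial_deriv_def)
  then show ?case
    using Suc by simp
qed simp

lemma Ck_on_add:
  assumes S: "openin (Euclidean_space n) S"
  shows "Ck_on n k S f \<Longrightarrow> Ck_on n k S g \<Longrightarrow> Ck_on n k S (\<lambda>x. f x + g x)"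
proof (induction k arbitrary: f g)
  case 0
  then show ?case
    by (auto intro: continuous_map_add)
next
  case (Suc k)
  have D: "((\<lambda>t. f (x(i := t)) + g (x(i := t))) has_real_derivative
            partial_deriv i f x + partial_deriv i g x) (at (x i))" if "x \<in> S" "i < n" for x i
    by (intro DERIV_add has_real_derivative_partial_deriv[OF Suc.prems(1) that]
        has_real_derivative_partial_deriv[OF Suc.prems(2) that])
  have "Ck_on n k S (partial_deriv i (\<lambda>x. f x + g x))" if "i < n" for i
  proof (rule Ck_on_cong[OF S])
    show "Ck_on n k S (\<lambda>x. partial_deriv i f x + partial_deriv i g x)"
      using Suc that by simp
    show "partial_deriv i f x + partial_deriv i g x = partial_deriv i (\<lambda>x. f x + g x) x"
      if "x \<in> S" for x
      using DERIV_imp_deriv[OF D[OF that \<open>i < n\<close>]] by (simp add: partial_deriv_def)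
  qed
  moreover have "(\<lambda>t. f (x(i := t)) + g (x(i := t))) differentiable at (x i)"
    if "x \<in> S" "i < n" for x i
    using D[OF that] unfolding real_differentiable_def by blast
  moreover have "continuous_map (subtopology (Euclidean_space n) S) euclideanreal (\<lambda>x. f x + g x)"
    using Suc.prems by (intro continuous_map_add) simp_all
  ultimately show ?case
    by simp
qed

lemma Ck_on_mult:
  assumes S: "openin (Euclidean_space n) S"
  shows "Ck_on n k S f \<Longrightarrow> Ck_on n k S g \<Longrightarrow> Ck_on n k S (\<lambda>x. f x * g x)"
proof (induction k arbitrary: f g)
  case 0
  then show ?case
    by (auto intro: continuous_map_real_mult)
next
  case (Suc k)
  have D: "((\<lambda>t. f (x(i := t)) * g (x(i := t))) has_real_derivative
            partial_deriv i f x * g x + partial_deriv i g x * f x) (at (x i))"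
    if "x \<in> S" "i < n" for x i
    using DERIV_mult[OF has_real_derivative_partial_deriv[OF Suc.prems(1) that]
        has_real_derivative_partial_deriv[OF Suc.prems(2) that]] by (simp only: fun_upd_triv)
  have "Ck_on n k S (partial_deriv i (\<lambda>x. f x * g x))" if "i < n" for i
  proof (rule Ck_on_cong[OF S])
    show "Ck_on n k S (\<lambda>x. partial_deriv i f x * g x + partial_deriv i g x * f x)"
      \<comment> \<open>The Leibniz formula also contains the undifferentiated factors, which must
        first be lowered from order \<open>Suc k\<close> to order \<open>k\<close>.\<close>
      using Suc.prems that Ck_on_SucD[OF Suc.prems(1)] Ck_on_SucD[OF Suc.prems(2)]
      by (intro Ck_on_add[OF S] Suc.IH) auto
    show "partial_deriv i f x * g x + partial_deriv i g x * f x
        = partial_deriv i (\<lambda>x. f x * g x) x" if "x \<in> S" for x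
      using DERIV_imp_deriv[OF D[OF that \<open>i < n\<close>]] by (simp add: partial_deriv_def)
  qed
  moreover have "(\<lambda>t. f (x(i := t)) * g (x(i := t))) differentiable at (x i)"
    if "x \<in> S" "i < n" for x i
    using D[OF that] unfolding real_differentiable_def by blast
  moreover have "continuous_map (subtopology (Euclidean_space n) S) euclideanreal (\<lambda>x. f x * g x)"
    using Suc.prems by (intro continuous_map_real_mult) simp_all
  ultimately show ?case
    by simp
qed

section \<open>The algebra of smooth functions on a manifold\<close>

locale smooth_mfd =
  fixes M :: "'a manifold"
  assumes smooth_manifold: "smooth_manifold M"
begin

lemma openin_chart_image:
  "(U, \<phi>) \<in> mfd_atlas M \<Longrightarrow> openin (Euclidean_space (mfd_dim M)) (\<phi> ` U)"
  using smooth_manifold by (auto simp: smooth_manifold_def is_chart_def)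

lemma smooth_functionsI:
  assumes "\<And>U \<phi> k. (U, \<phi>) \<in> mfd_atlas M \<Longrightarrow>
      Ck_on (mfd_dim M) k (\<phi> ` U) (\<lambda>x. f (inv_into U \<phi> x))"
    and "\<And>p. p \<notin> pts M \<Longrightarrow> f p = 0"
  shows "f \<in> smooth_functions M"
  using assms unfolding smooth_functions_def Cinf_on_def by blast

lemma smooth_functions_Ck_on:
  assumes "f \<in> smooth_functions M" "(U, \<phi>) \<in> mfd_atlas M"
  shows "Ck_on (mfd_dim M) k (\<phi> ` U) (\<lambda>x. f (inv_into U \<phi> x))"
  using assms unfolding smooth_functions_def Cinf_on_def by blast

lemma smooth_functions_off_pts:
  "f \<in> smooth_functions M \<Longrightarrow> p \<notin> pts M \<Longrightarrow> f p = 0"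
  unfolding smooth_functions_def by blast

lemma smooth_add:
  assumes "f \<in> smooth_functions M" "g \<in> smooth_functions M"
  shows "(\<lambda>p. f p + g p) \<in> smooth_functions M"
proof (rule smooth_functionsI)
  fix U \<phi> k assume "(U, \<phi>) \<in> mfd_atlas M"
  then show "Ck_on (mfd_dim M) k (\<phi> ` U) (\<lambda>x. f (inv_into U \<phi> x) + g (inv_into U \<phi> x))"
    by (intro Ck_on_add openin_chart_image assms smooth_functions_Ck_on)
qed (simp add: assms smooth_functions_off_pts)

lemma smooth_mult:
  assumes "f \<in> smooth_functions M" "g \<in> smooth_functions M"
  shows "(\<lambda>p. f p * g p) \<in> smooth_functions M"
proof (rule smooth_functionsI)
  fix U \<phi> k assume "(U, \<phi>) \<in> mfd_atlas M"
  then show "Ck_on (mfd_dim M) k (\<phi> ` U) (\<lambda>x. f (inv_into U \<phi> x) * g (inv_into U \<phi> x))"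
    by (intro Ck_on_mult openin_chart_image assms smooth_functions_Ck_on)
qed (simp add: assms smooth_functions_off_pts)

lemma smooth_cmult:
  assumes "f \<in> smooth_functions M"
  shows "(\<lambda>p. c * f p) \<in> smooth_functions M"
proof (rule smooth_functionsI)
  fix U \<phi> k assume "(U, \<phi>) \<in> mfd_atlas M"
  then show "Ck_on (mfd_dim M) k (\<phi> ` U) (\<lambda>x. c * f (inv_into U \<phi> x))"
    by (intro Ck_on_mult Ck_on_const openin_chart_image assms smooth_functions_Ck_on)
qed (simp add: assms smooth_functions_off_pts)

lemma smooth_zero: "(\<lambda>p. 0) \<in> smooth_functions M"
  by (intro smooth_functionsI Ck_on_const refl)

lemma smooth_diff:
  assumes "f \<in> smooth_functions M" "g \<in> smooth_functions M"
  shows "(\<lambda>p. f p - g p) \<in> smooth_functions M"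
  using smooth_add[OF assms(1) smooth_cmult[OF assms(2), of "-1"]] by simp

lemma smooth_sum:
  assumes "\<And>i. i \<in> A \<Longrightarrow> f i \<in> smooth_functions M"
  shows "(\<lambda>p. \<Sum>i\<in>A. f i p) \<in> smooth_functions M"
  using assms by (induction A rule: infinite_finite_induct) (auto intro: smooth_zero smooth_add)

section \<open>Vector fields\<close>

text \<open>Vanishing off \<open>pts M\<close> comes for free: \<open>X p f\<close>, as a function
  of \<open>p\<close>, is smooth or identically zero, and smooth functions are zero there by
  convention. The conditions can thus be checked at all \<open>p\<close> alike.\<close>

lemma vector_fieldsI:
  assumes "\<And>p f g. f \<in> smooth_functions M \<Longrightarrow> g \<in> smooth_functions M \<Longrightarrow>
             X p (\<lambda>q. f q + g q) = X p f + X p g"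
    and "\<And>p f g. f \<in> smooth_functions M \<Longrightarrow> g \<in> smooth_functions M \<Longrightarrow>
             X p (\<lambda>q. f q * g q) = X p f * g p + f p * X p g"
    and "\<And>p f c. f \<in> smooth_functions M \<Longrightarrow> X p (\<lambda>q. c * f q) = c * X p f"
    and nonsmooth: "\<And>p f. f \<notin> smooth_functions M \<Longrightarrow> X p f = 0"
    and smooth: "\<And>f. f \<in> smooth_functions M \<Longrightarrow> (\<lambda>p. X p f) \<in> smooth_functions M"
  shows "X \<in> vector_fields M"
proof -
  have "X p f = 0" if "p \<notin> pts M" for p f
    using nonsmooth[of f] smooth[of f] that by (cases "f \<in> smooth_functions M")
      (auto dest: smooth_functions_off_pts)
  then show ?thesis
    using assms by (auto simp: vector_fields_def tangent_space_def vact_def)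
qed

section \<open>Derivation rules for a single vector field\<close>

context
  fixes X assumes X: "X \<in> vector_fields M"
begin

lemma vf_off_pts: "p \<notin> pts M \<Longrightarrow> X p f = 0"
  using X by (auto simp: vector_fields_def)

lemma vf_add:
  "f \<in> smooth_functions M \<Longrightarrow> g \<in> smooth_functions M \<Longrightarrow> X p (\<lambda>q. f q + g q) = X p f + X p g"
  using X vf_off_pts[of p] by (cases "p \<in> pts M") (auto simp: vector_fields_def tangent_space_def)

lemma vf_mult:
  "f \<in> smooth_functions M \<Longrightarrow> g \<in> smooth_functions M \<Longrightarrow>
     X p (\<lambda>q. f q * g q) = X p f * g p + f p * X p g"
  using X vf_off_pts[of p] by (cases "p \<in> pts M") (auto simp: vector_fields_def tangent_space_def)

lemma vf_cmult: "f \<in> smooth_functions M \<Longrightarrow> X p (\<lambda>q. c * f q) = c * X p f"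
  using X vf_off_pts[of p] by (cases "p \<in> pts M") (auto simp: vector_fields_def tangent_space_def)

lemma vf_nonsmooth: "f \<notin> smooth_functions M \<Longrightarrow> X p f = 0"
  using X vf_off_pts[of p] by (cases "p \<in> pts M") (auto simp: vector_fields_def tangent_space_def)

lemma vf_smooth: "f \<in> smooth_functions M \<Longrightarrow> (\<lambda>p. X p f) \<in> smooth_functions M"
  using X by (auto simp: vector_fields_def vact_def)

lemma vf_zero: "X p (\<lambda>q. 0) = 0"
  using vf_cmult[OF smooth_zero, of p 0] by simp

lemma vf_diff:
  assumes "f \<in> smooth_functions M" "g \<in> smooth_functions M"
  shows "X p (\<lambda>q. f q - g q) = X p f - X p g"
  using vf_add[OF assms(1) smooth_cmult[OF assms(2), of "-1"], of p] vf_cmult[OF assms(2), of p "-1"]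
  by simp

lemma vf_sum:
  assumes "\<And>i. i \<in> A \<Longrightarrow> f i \<in> smooth_functions M"
  shows "X p (\<lambda>q. \<Sum>i\<in>A. f i q) = (\<Sum>i\<in>A. X p (f i))"
  using assms
  by (induction A rule: infinite_finite_induct) (auto simp: vf_zero vf_add smooth_sum)

end

text \<open>Tangent vectors are zero on nonsmooth arguments by convention, so testing on smooth
  functions decides equality in HOL.\<close>

lemma vf_eq_vzeroI:
  assumes "X \<in> vector_fields M" "\<And>p f. f \<in> smooth_functions M \<Longrightarrow> X p f = 0"
  shows "X = vzero"
  unfolding vzero_def using assms vf_nonsmooth[OF assms(1)] by (intro ext) metis

lemmas vf_simps = vf_add vf_mult vf_cmult vf_nonsmooth vf_smooth vf_zero vf_diff
  smooth_add smooth_mult smooth_cmult smooth_diff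

section \<open>Closure properties of the vector fields\<close>

lemma vzero_in_vector_fields: "vzero \<in> vector_fields M"
  by (rule vector_fieldsI) (auto simp: vzero_def smooth_zero)

lemma vminus_in_vector_fields:
  "X \<in> vector_fields M \<Longrightarrow> Y \<in> vector_fields M \<Longrightarrow> vminus X Y \<in> vector_fields M"
  by (rule vector_fieldsI) (auto simp: vminus_def vf_simps algebra_simps)

lemma vscale_in_vector_fields:
  "h \<in> smooth_functions M \<Longrightarrow> X \<in> vector_fields M \<Longrightarrow> vscale h X \<in> vector_fields M"
  by (rule vector_fieldsI) (auto simp: vscale_def vf_simps algebra_simps)

text \<open>In \<open>X (Y (f g))\<close> the cross terms \<open>X f * Y g + Y f * X g\<close> are
  symmetric in \<open>X\<close> and \<open>Y\<close>, so they cancel in the commutator and the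
  Leibniz rule survives.\<close>

lemma lie_bracket_in_vector_fields:
  assumes X: "X \<in> vector_fields M" and Y: "Y \<in> vector_fields M"
  shows "lie_bracket X Y \<in> vector_fields M"
proof -
  note smooth = vf_smooth[OF X] vf_smooth[OF Y] smooth_add smooth_mult smooth_cmult smooth_diff
  note simps = vf_add[OF X] vf_add[OF Y] vf_mult[OF X] vf_mult[OF Y] vf_cmult[OF X] vf_cmult[OF Y]
    vf_zero[OF X] vf_zero[OF Y] vf_nonsmooth[OF X] vf_nonsmooth[OF Y]
  show ?thesis
    by (rule vector_fieldsI) (simp_all add: lie_bracket_def vact_def simps smooth algebra_simps)
qed

section \<open>Covariant tensors\<close>

lemma vf_tuples_Cons_iff:
  "X # Xs \<in> vf_tuples M (Suc k) \<longleftrightarrow> X \<in> vector_fields M \<and> Xs \<in> vf_tuples M k"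
  by (auto simp: vf_tuples_def)

lemma vf_tuples_SucE:
  assumes "Xs \<in> vf_tuples M (Suc k)"
  obtains X Zs where "Xs = X # Zs" "X \<in> vector_fields M" "Zs \<in> vf_tuples M k"
  using assms by (cases Xs) (auto simp: vf_tuples_def)

lemma vf_tuples_update:
  "Xs \<in> vf_tuples M k \<Longrightarrow> Y \<in> vector_fields M \<Longrightarrow> Xs[i := Y] \<in> vf_tuples M k"
  using set_update_subset_insert[of Xs i Y] by (auto simp: vf_tuples_def)

lemma vf_tuples_nth: "Xs \<in> vf_tuples M k \<Longrightarrow> i < k \<Longrightarrow> Xs ! i \<in> vector_fields M"
  by (auto simp: vf_tuples_def)

lemma vf_tuples_length: "Xs \<in> vf_tuples M k \<Longrightarrow> length Xs = k"
  by (simp add: vf_tuples_def)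

context
  fixes \<omega> k assumes \<omega>: "\<omega> \<in> covariant_tensors M k"
begin

lemma tensor_smooth: "Xs \<in> vf_tuples M k \<Longrightarrow> \<omega> Xs \<in> smooth_functions M"
  using \<omega> by (auto simp: covariant_tensors_def)

lemma tensor_vadd:
  assumes "Xs \<in> vf_tuples M k" "i < k" "Y \<in> vector_fields M" "Z \<in> vector_fields M"
  shows "\<omega> (Xs[i := vadd Y Z]) = (\<lambda>p. \<omega> (Xs[i := Y]) p + \<omega> (Xs[i := Z]) p)"
  using \<omega> assms by (auto simp: covariant_tensors_def)

lemma tensor_vscale:
  assumes "Xs \<in> vf_tuples M k" "i < k" "h \<in> smooth_functions M" "Y \<in> vector_fields M"
  shows "\<omega> (Xs[i := vscale h Y]) = (\<lambda>p. h p * \<omega> (Xs[i := Y]) p)"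
  using \<omega> assms by (auto simp: covariant_tensors_def)

lemma tensor_vminus:
  assumes "Xs \<in> vf_tuples M k" "i < k" "Y \<in> vector_fields M" "Z \<in> vector_fields M"
  shows "\<omega> (Xs[i := vminus Y Z]) p = \<omega> (Xs[i := Y]) p - \<omega> (Xs[i := Z]) p"
proof -
  \<comment> \<open>Tensors are additive by definition; compatibility with differences is read off
    from Y = (Y - Z) + Z.\<close>
  have "vadd (vminus Y Z) Z = Y"
    by (simp add: vadd_def vminus_def)
  then show ?thesis
    using tensor_vadd[OF assms(1,2) vminus_in_vector_fields[OF assms(3,4)] assms(4)] by simp
qed

lemma tensor_vzero:
  assumes "Xs \<in> vf_tuples M k" "i < k"
  shows "\<omega> (Xs[i := vzero]) p = 0"
  using tensor_vminus[OF assms vzero_in_vector_fields vzero_in_vector_fields, of p]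
  by (simp add: vminus_def vzero_def)

end

end

section \<open>The Ricci identity\<close>

locale koszul_connection = smooth_mfd M for M :: "'a manifold" +
  fixes D :: "'a vfield \<Rightarrow> 'a vfield \<Rightarrow> 'a vfield"
  assumes connection: "connection M D"
begin

lemma D_in_vector_fields:
  "X \<in> vector_fields M \<Longrightarrow> Y \<in> vector_fields M \<Longrightarrow> D X Y \<in> vector_fields M"
  using connection by (auto simp: connection_def)

lemma D_vadd_left:
  assumes "X \<in> vector_fields M" "X' \<in> vector_fields M" "Y \<in> vector_fields M"
  shows "D (vadd X X') Y = vadd (D X Y) (D X' Y)"
  using connection assms by (auto simp: connection_def)

lemma D_vscale_left:
  assumes "h \<in> smooth_functions M" "X \<in> vector_fields M" "Y \<in> vector_fields M"
  shows "D (vscale h X) Y = vscale h (D X Y)"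
  using connection assms by (auto simp: connection_def)

lemma D_vadd_right:
  assumes "X \<in> vector_fields M" "Y \<in> vector_fields M" "Y' \<in> vector_fields M"
  shows "D X (vadd Y Y') = vadd (D X Y) (D X Y')"
  using connection assms by (auto simp: connection_def)

lemma D_vscale_right:
  assumes "h \<in> smooth_functions M" "X \<in> vector_fields M" "Y \<in> vector_fields M"
  shows "D X (vscale h Y) = vadd (vscale (vact X h) Y) (vscale h (D X Y))"
  using connection assms by (auto simp: connection_def)

lemma torsion_in_vector_fields:
  assumes "X \<in> vector_fields M" "Y \<in> vector_fields M"
  shows "torsion D X Y \<in> vector_fields M"
  unfolding torsion_def
  by (intro vminus_in_vector_fields lie_bracket_in_vector_fields D_in_vector_fields assms)

lemma curvature_in_vector_fields:
  assumes "X \<in> vector_fields M" "Y \<in> vector_fields M" "Z \<in> vector_fields M"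
  shows "curvature D X Y Z \<in> vector_fields M"
  unfolding curvature_def
  by (intro vminus_in_vector_fields lie_bracket_in_vector_fields D_in_vector_fields assms)

lemma cov_deriv_Cons:
  "cov_deriv D \<omega> (X # Zs) p =
     X p (\<omega> Zs) - (\<Sum>i<length Zs. \<omega> (Zs[i := D X (Zs ! i)]) p)"
  by (simp add: cov_deriv_def vact_def)

section \<open>Tensoriality of the covariant derivative\<close>

context
  fixes \<omega> k assumes \<omega>: "\<omega> \<in> covariant_tensors M k"
begin

lemma cov_deriv_smooth:
  assumes X: "X \<in> vector_fields M" and Zs: "Zs \<in> vf_tuples M k"
  shows "cov_deriv D \<omega> (X # Zs) \<in> smooth_functions M"
proof -
  have "\<omega> (Zs[i := D X (Zs ! i)]) \<in> smooth_functions M" if "i < length Zs" for i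
    using that vf_tuples_length[OF Zs]
    by (intro tensor_smooth[OF \<omega>] vf_tuples_update Zs D_in_vector_fields X vf_tuples_nth[OF Zs]) simp
  then have "(\<lambda>p. X p (\<omega> Zs) - (\<Sum>i<length Zs. \<omega> (Zs[i := D X (Zs ! i)]) p)) \<in> smooth_functions M"
    using vf_smooth[OF X tensor_smooth[OF \<omega> Zs]] by (intro smooth_diff smooth_sum) simp_all
  then show ?thesis
    by (simp add: cov_deriv_Cons[abs_def])
qed

lemma cov_deriv_head_vadd:
  assumes "X \<in> vector_fields M" "Y \<in> vector_fields M" and Zs: "Zs \<in> vf_tuples M k"
  shows "cov_deriv D \<omega> (vadd X Y # Zs) p = cov_deriv D \<omega> (X # Zs) p + cov_deriv D \<omega> (Y # Zs) p"
proof -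
  have "\<omega> (Zs[i := D (vadd X Y) (Zs ! i)]) p
      = \<omega> (Zs[i := D X (Zs ! i)]) p + \<omega> (Zs[i := D Y (Zs ! i)]) p" if "i < k" for i
    using assms that
    by (simp add: D_vadd_left vf_tuples_nth tensor_vadd[OF \<omega>] D_in_vector_fields)
  then show ?thesis
    using vf_tuples_length[OF Zs] by (simp add: cov_deriv_Cons vadd_def sum.distrib)
qed

lemma cov_deriv_head_vscale:
  assumes "h \<in> smooth_functions M" "X \<in> vector_fields M" and Zs: "Zs \<in> vf_tuples M k"
  shows "cov_deriv D \<omega> (vscale h X # Zs) p = h p * cov_deriv D \<omega> (X # Zs) p"
proof -
  have "\<omega> (Zs[i := D (vscale h X) (Zs ! i)]) p = h p * \<omega> (Zs[i := D X (Zs ! i)]) p"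
    if "i < k" for i
    using assms that
    by (simp add: D_vscale_left vf_tuples_nth tensor_vscale[OF \<omega>] D_in_vector_fields)
  then show ?thesis
    using vf_tuples_length[OF Zs]
    by (simp add: cov_deriv_Cons vscale_def sum_distrib_left right_diff_distrib)
qed

lemma cov_deriv_tail_vadd:
  assumes X: "X \<in> vector_fields M" and Zs: "Zs \<in> vf_tuples M k" and j: "j < k"
    and Y: "Y \<in> vector_fields M" and Z: "Z \<in> vector_fields M"
  shows "cov_deriv D \<omega> (X # Zs[j := vadd Y Z]) p
       = cov_deriv D \<omega> (X # Zs[j := Y]) p + cov_deriv D \<omega> (X # Zs[j := Z]) p"
proof -
  note [simp] = vf_tuples_length[OF Zs]
  \<comment> \<open>\<open>u W i\<close> is the \<open>i\<close>-th summand of the covariant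
    derivative once argument \<open>j\<close> is \<open>W\<close>. For \<open>i = j\<close> the
    connection acts on \<open>W\<close> itself; otherwise \<open>W\<close> is a plain argument of
    \<omega>, since updates at different positions commute.\<close>
  define u where "u W i = \<omega> ((Zs[j := W])[i := D X (Zs[j := W] ! i)]) p" for W i
  have "u (vadd Y Z) i = u Y i + u Z i" if "i < k" for i
  proof (cases "i = j")
    case True
    then show ?thesis
      using assms by (simp add: u_def D_vadd_right tensor_vadd[OF \<omega>] D_in_vector_fields)
  next
    case False
    then have "u W i = \<omega> ((Zs[i := D X (Zs ! i)])[j := W]) p" for W
      by (simp add: u_def list_update_swap)
    then show ?thesis
      using assms \<open>i < k\<close>
      by (simp add: tensor_vadd[OF \<omega>] D_in_vector_fields vf_tuples_update vf_tuples_nth)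
  qed
  moreover have "X p (\<omega> (Zs[j := vadd Y Z])) = X p (\<omega> (Zs[j := Y])) + X p (\<omega> (Zs[j := Z]))"
    using assms by (simp add: tensor_vadd[OF \<omega>] vf_add tensor_smooth[OF \<omega>] vf_tuples_update)
  ultimately show ?thesis
    by (simp add: cov_deriv_Cons flip: u_def) (simp add: sum.distrib)
qed

text \<open>Differentiating \<open>h\<close> times a value of \<omega> produces a term with
  \<open>X p h\<close>. The summand \<open>i = j\<close> produces the same term from
  \<open>D X (vscale h Y)\<close>, and the minus sign in \<open>cov_deriv\<close> cancels the
  two.\<close>

lemma cov_deriv_tail_vscale:
  assumes X: "X \<in> vector_fields M" and Zs: "Zs \<in> vf_tuples M k" and j: "j < k"
    and h: "h \<in> smooth_functions M" and Y: "Y \<in> vector_fields M"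
  shows "cov_deriv D \<omega> (X # Zs[j := vscale h Y]) p = h p * cov_deriv D \<omega> (X # Zs[j := Y]) p"
proof -
  note [simp] = vf_tuples_length[OF Zs]
  define u where "u W i = \<omega> ((Zs[j := W])[i := D X (Zs[j := W] ! i)]) p" for W i
  have "u (vscale h Y) i = h p * u Y i + (if i = j then X p h * \<omega> (Zs[j := Y]) p else 0)"
    if "i < k" for i
  proof (cases "i = j")
    case True
    have "vact X h \<in> smooth_functions M"
      using X h by (simp add: vact_def vf_smooth)
    then show ?thesis
      using assms True
      by (simp add: u_def D_vscale_right tensor_vadd[OF \<omega>] tensor_vscale[OF \<omega>]
          vscale_in_vector_fields D_in_vector_fields) (simp add: vact_def)
  next
    case False
    then have "u W i = \<omega> ((Zs[i := D X (Zs ! i)])[j := W]) p" for W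
      by (simp add: u_def list_update_swap)
    then show ?thesis
      using assms \<open>i < k\<close> False
      by (simp add: tensor_vscale[OF \<omega>] D_in_vector_fields vf_tuples_update vf_tuples_nth)
  qed
  moreover have "X p (\<omega> (Zs[j := vscale h Y])) = X p h * \<omega> (Zs[j := Y]) p + h p * X p (\<omega> (Zs[j := Y]))"
    using assms by (simp add: tensor_vscale[OF \<omega>] vf_mult tensor_smooth[OF \<omega>] vf_tuples_update)
  ultimately show ?thesis
    using j by (simp add: cov_deriv_Cons flip: u_def)
      (simp add: sum.distrib sum_distrib_left right_diff_distrib)
qed

lemma cov_deriv_in_covariant_tensors: "cov_deriv D \<omega> \<in> covariant_tensors M (Suc k)"
proof -
  have "cov_deriv D \<omega> (Xs[i := vadd Y Z])
      = (\<lambda>p. cov_deriv D \<omega> (Xs[i := Y]) p + cov_deriv D \<omega> (Xs[i := Z]) p)"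
    if "Xs \<in> vf_tuples M (Suc k)" "i < Suc k" "Y \<in> vector_fields M" "Z \<in> vector_fields M" for Xs i Y Z
    \<comment> \<open>Index 0 is the direction of differentiation; every later index is an argument
      of \<omega>.\<close>
    using that by (cases i) (auto elim!: vf_tuples_SucE simp: cov_deriv_head_vadd cov_deriv_tail_vadd)
  moreover have "cov_deriv D \<omega> (Xs[i := vscale h Y]) = (\<lambda>p. h p * cov_deriv D \<omega> (Xs[i := Y]) p)"
    if "Xs \<in> vf_tuples M (Suc k)" "i < Suc k" "h \<in> smooth_functions M" "Y \<in> vector_fields M" for Xs i h Y
    using that by (cases i) (auto elim!: vf_tuples_SucE simp: cov_deriv_head_vscale cov_deriv_tail_vscale)
  ultimately show ?thesis
    by (auto simp: covariant_tensors_def elim!: vf_tuples_SucE intro: cov_deriv_smooth)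
qed

end

text \<open>The terms are grouped by their behaviour under exchange of \<open>X\<close> and
  \<open>Y\<close>: the two single sums of first derivatives are exchanged with each other, and the
  off-diagonal double sum is symmetric. Only the remaining three groups contribute to the
  commutator.\<close>

lemma second_cov_deriv_expand:
  assumes \<omega>: "\<omega> \<in> covariant_tensors M k"
    and X: "X \<in> vector_fields M" and Y: "Y \<in> vector_fields M" and Zs: "Zs \<in> vf_tuples M k"
  shows "cov_deriv D (cov_deriv D \<omega>) (X # Y # Zs) p =
      X p (vact Y (\<omega> Zs))
      - (\<Sum>i<k. X p (\<omega> (Zs[i := D Y (Zs ! i)]))) - (\<Sum>i<k. Y p (\<omega> (Zs[i := D X (Zs ! i)])))
      - cov_deriv D \<omega> (D X Y # Zs) p
      + (\<Sum>i<k. \<omega> (Zs[i := D Y (D X (Zs ! i))]) p)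
      + (\<Sum>i<k. \<Sum>j<k. if i = j then 0 else \<omega> (Zs[i := D X (Zs ! i), j := D Y (Zs ! j)]) p)"
proof -
  note [simp] = vf_tuples_length[OF Zs]
  have sm: "\<omega> (Zs[i := D W (Zs ! i)]) \<in> smooth_functions M" if "W \<in> vector_fields M" "i < k" for W i
    using that by (intro tensor_smooth[OF \<omega>] vf_tuples_update Zs D_in_vector_fields vf_tuples_nth[OF Zs])
  have sum: "X p (\<lambda>q. \<Sum>i<k. \<omega> (Zs[i := D Y (Zs ! i)]) q) = (\<Sum>i<k. X p (\<omega> (Zs[i := D Y (Zs ! i)])))"
    by (rule vf_sum[OF X]) (simp add: sm Y)
  have "X p (cov_deriv D \<omega> (Y # Zs))
      = X p (\<lambda>q. Y q (\<omega> Zs) - (\<Sum>i<k. \<omega> (Zs[i := D Y (Zs ! i)]) q))"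
    by (simp add: cov_deriv_Cons[abs_def])
  also have "\<dots> = X p (vact Y (\<omega> Zs)) - (\<Sum>i<k. X p (\<omega> (Zs[i := D Y (Zs ! i)])))"
    using Y tensor_smooth[OF \<omega> Zs]
    by (subst vf_diff[OF X]) (auto simp: vact_def vf_smooth sm sum intro!: smooth_sum)
  finally have 1: "X p (cov_deriv D \<omega> (Y # Zs))
      = X p (vact Y (\<omega> Zs)) - (\<Sum>i<k. X p (\<omega> (Zs[i := D Y (Zs ! i)])))" .
  have 2: "cov_deriv D \<omega> (Y # Zs[i := D X (Zs ! i)]) p
      = Y p (\<omega> (Zs[i := D X (Zs ! i)])) - \<omega> (Zs[i := D Y (D X (Zs ! i))]) p
        - (\<Sum>j<k. if i = j then 0 else \<omega> (Zs[i := D X (Zs ! i), j := D Y (Zs ! j)]) p)"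
    if "i < k" for i
  proof -
    \<comment> \<open>The summand \<open>j = i\<close> differentiates the entry already replaced and
      gives a second derivative of \<open>Zs ! i\<close>; every other summand changes a second,
      different entry.\<close>
    have "(\<Sum>j<k. \<omega> (Zs[i := D X (Zs ! i), j := D Y (Zs[i := D X (Zs ! i)] ! j)]) p)
        = (\<Sum>j<k. (if i = j then \<omega> (Zs[i := D Y (D X (Zs ! i))]) p else 0) +
                 (if i = j then 0 else \<omega> (Zs[i := D X (Zs ! i), j := D Y (Zs ! j)]) p))"
      by (intro sum.cong) auto
    also have "\<dots> = \<omega> (Zs[i := D Y (D X (Zs ! i))]) p
        + (\<Sum>j<k. if i = j then 0 else \<omega> (Zs[i := D X (Zs ! i), j := D Y (Zs ! j)]) p)"
      using that by (simp add: sum.distrib)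
    finally show ?thesis
      by (simp add: cov_deriv_Cons)
  qed
  have "cov_deriv D (cov_deriv D \<omega>) (X # Y # Zs) p
      = X p (cov_deriv D \<omega> (Y # Zs)) - cov_deriv D \<omega> (D X Y # Zs) p
        - (\<Sum>i<k. cov_deriv D \<omega> (Y # Zs[i := D X (Zs ! i)]) p)"
    \<comment> \<open>The shift splits off index 0 of the argument list \<open>Y # Zs\<close>, where
      the connection acts on \<open>Y\<close>.\<close>
    by (subst cov_deriv_Cons) (simp add: sum.lessThan_Suc_shift del: sum.lessThan_Suc)
  then show ?thesis
    by (simp add: 1 2 sum_subtractf)
qed

text \<open>After cancellation of the symmetric terms, X(Y \<omega>) - Y(X \<omega>) is the
  derivative along \<open>lie_bracket X Y\<close>. By the definition of \<nabla>\<omega> it splits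
  into a value of \<nabla>\<omega>, which completes \<open>D X Y\<close> minus \<open>D Y X\<close>
  to the torsion, and a sum that completes the commutators of \<open>D X\<close> and
  \<open>D Y\<close> to the curvature.\<close>

lemma Ricci_identity:
  assumes \<omega>: "\<omega> \<in> covariant_tensors M k"
    and X: "X \<in> vector_fields M" and Y: "Y \<in> vector_fields M" and Zs: "Zs \<in> vf_tuples M k"
  shows "cov_deriv D (cov_deriv D \<omega>) (X # Y # Zs) p - cov_deriv D (cov_deriv D \<omega>) (Y # X # Zs) p
       = - cov_deriv D \<omega> (torsion D X Y # Zs) p
         - (\<Sum>i<k. \<omega> (Zs[i := curvature D X Y (Zs ! i)]) p)"
proof -
  note VF = vminus_in_vector_fields lie_bracket_in_vector_fields D_in_vector_fields
  have swap: "(\<Sum>i<k. \<Sum>j<k. if i = j then 0 else \<omega> (Zs[i := D X (Zs ! i), j := D Y (Zs ! j)]) p)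
      = (\<Sum>i<k. \<Sum>j<k. if i = j then 0 else \<omega> (Zs[i := D Y (Zs ! i), j := D X (Zs ! j)]) p)"
    \<comment> \<open>Exchanging the summation indices is harmless because updates at distinct
      positions commute.\<close>
    by (subst sum.swap) (auto intro!: sum.cong simp: list_update_swap)
  have curv: "\<omega> (Zs[i := curvature D X Y (Zs ! i)]) p
      = \<omega> (Zs[i := D X (D Y (Zs ! i))]) p - \<omega> (Zs[i := D Y (D X (Zs ! i))]) p
        - \<omega> (Zs[i := D (lie_bracket X Y) (Zs ! i)]) p" if "i < k" for i
    unfolding curvature_def
    by (simp add: tensor_vminus[OF \<omega> Zs that] VF X Y vf_tuples_nth[OF Zs that])
  have hd: "cov_deriv D \<omega> (vminus V W # Zs) p = cov_deriv D \<omega> (V # Zs) p - cov_deriv D \<omega> (W # Zs) p"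
    if "V \<in> vector_fields M" "W \<in> vector_fields M" for V W
    using tensor_vminus[OF cov_deriv_in_covariant_tensors[OF \<omega>], of "V # Zs" 0 V W p] that Zs
    by (simp add: vf_tuples_Cons_iff)
  have tors: "cov_deriv D \<omega> (torsion D X Y # Zs) p = cov_deriv D \<omega> (D X Y # Zs) p
      - cov_deriv D \<omega> (D Y X # Zs) p - cov_deriv D \<omega> (lie_bracket X Y # Zs) p"
    unfolding torsion_def by (simp add: hd VF X Y)
  have br: "cov_deriv D \<omega> (lie_bracket X Y # Zs) p = X p (vact Y (\<omega> Zs)) - Y p (vact X (\<omega> Zs))
      - (\<Sum>i<k. \<omega> (Zs[i := D (lie_bracket X Y) (Zs ! i)]) p)"
    by (subst cov_deriv_Cons) (simp add: lie_bracket_def[of X Y, THEN fun_cong, THEN fun_cong] vf_tuples_length[OF Zs])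
  show ?thesis
    by (simp add: second_cov_deriv_expand[OF \<omega> X Y Zs] second_cov_deriv_expand[OF \<omega> Y X Zs]
        curv tors br swap sum_subtractf)
qed

section \<open>Symmetry of the iterated derivatives\<close>

lemma cov_deriv_pow_in_covariant_tensors:
  assumes "f \<in> smooth_functions M"
  shows "cov_deriv_pow D n f \<in> covariant_tensors M n"
proof (induction n)
  case 0
  then show ?case
    using assms by (simp add: covariant_tensors_def)
next
  case (Suc n)
  then show ?case
    by (simp add: cov_deriv_in_covariant_tensors)
qed

text \<open>Two lists are rearrangements of each other exactly if their multisets agree. In this
  form symmetry can be handled by adding and removing list entries, without explicit
  permutations.\<close>

lemma symmetric_tensor_iff_mset:
  assumes "\<omega> \<in> covariant_tensors M n"
  shows "symmetric_tensor M n \<omega> \<longleftrightarrow>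
    (\<forall>Xs\<in>vf_tuples M n. \<forall>Ys\<in>vf_tuples M n. mset Xs = mset Ys \<longrightarrow> \<omega> Xs = \<omega> Ys)" (is "_ \<longleftrightarrow> ?R")
proof
  assume L: "symmetric_tensor M n \<omega>"
  show ?R
  proof (intro ballI impI)
    fix Xs Ys assume XY: "Xs \<in> vf_tuples M n" "Ys \<in> vf_tuples M n" "mset Xs = mset Ys"
    then obtain \<sigma> where "\<sigma> permutes {..<length Ys}" "permute_list \<sigma> Ys = Xs"
      using mset_eq_permutation by metis
    then show "\<omega> Xs = \<omega> Ys"
      using L XY vf_tuples_length[OF XY(2)] by (auto simp: symmetric_tensor_def)
  qed
next
  assume R: ?R
  have "\<omega> (permute_list \<sigma> Xs) = \<omega> Xs" if "\<sigma> permutes {..<n}" "Xs \<in> vf_tuples M n" for \<sigma> Xs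
  proof -
    have \<sigma>: "\<sigma> permutes {..<length Xs}"
      using that by (simp add: vf_tuples_length)
    then have "permute_list \<sigma> Xs \<in> vf_tuples M n"
      using that by (simp add: vf_tuples_def)
    then show ?thesis
      using R that(2) mset_permute_list[OF \<sigma>] by blast
  qed
  then show "symmetric_tensor M n \<omega>"
    using assms by (simp add: symmetric_tensor_def)
qed

lemma symmetric_tensor_swap:
  assumes "symmetric_tensor M (Suc (Suc k)) \<omega>" "X \<in> vector_fields M" "Y \<in> vector_fields M"
    "Zs \<in> vf_tuples M k"
  shows "\<omega> (X # Y # Zs) = \<omega> (Y # X # Zs)"
proof -
  have "\<omega> \<in> covariant_tensors M (Suc (Suc k))"
    using assms(1) by (simp add: symmetric_tensor_def)
  from symmetric_tensor_iff_mset[OF this] assms show ?thesis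
    by (simp add: vf_tuples_Cons_iff add_mset_commute)
qed

text \<open>If \<sigma> carries \<open>Zs\<close> to \<open>Ys\<close>, differentiating entry
  \<open>i\<close> of \<open>Ys\<close> gives a rearrangement of \<open>Zs\<close> with entry
  \<open>\<sigma> i\<close> differentiated. The sums therefore agree after reindexing by
  \<sigma>.\<close>

lemma symmetric_cov_deriv_tail:
  assumes sym: "symmetric_tensor M k \<omega>"
    and X: "X \<in> vector_fields M" and Ys: "Ys \<in> vf_tuples M k" and Zs: "Zs \<in> vf_tuples M k"
    and eq: "mset Ys = mset Zs"
  shows "cov_deriv D \<omega> (X # Ys) = cov_deriv D \<omega> (X # Zs)"
proof
  fix p
  have inv: "\<omega> As = \<omega> Bs" if "As \<in> vf_tuples M k" "Bs \<in> vf_tuples M k" "mset As = mset Bs" for As Bs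
    using sym symmetric_tensor_iff_mset[of \<omega> k] that unfolding symmetric_tensor_def by blast
  note len = vf_tuples_length[OF Ys] vf_tuples_length[OF Zs]
  obtain \<sigma> where \<sigma>: "\<sigma> permutes {..<k}" and Ys_eq: "permute_list \<sigma> Zs = Ys"
    using mset_eq_permutation[OF eq] len by metis
  have "\<omega> (Ys[i := D X (Ys ! i)]) p = \<omega> (Zs[\<sigma> i := D X (Zs ! \<sigma> i)]) p" if "i < k" for i
  proof -
    have \<sigma>i: "\<sigma> i < k"
      using permutes_in_image[OF \<sigma>, of i] that by simp
    have nth: "Ys ! i = Zs ! \<sigma> i"
      using permute_list_nth[of \<sigma> Zs i] \<sigma> that len Ys_eq by simp
    have "mset (Ys[i := D X (Ys ! i)]) = mset (Zs[\<sigma> i := D X (Zs ! \<sigma> i)])"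
      using that \<sigma>i len by (simp add: mset_update nth eq)
    then have "\<omega> (Ys[i := D X (Ys ! i)]) = \<omega> (Zs[\<sigma> i := D X (Zs ! \<sigma> i)])"
      by (intro inv vf_tuples_update D_in_vector_fields X Ys Zs vf_tuples_nth[OF Ys that]
          vf_tuples_nth[OF Zs \<sigma>i])
    then show ?thesis
      by simp
  qed
  then have "(\<Sum>i<k. \<omega> (Ys[i := D X (Ys ! i)]) p) = (\<Sum>i<k. \<omega> (Zs[\<sigma> i := D X (Zs ! \<sigma> i)]) p)"
    by simp
  also have "\<dots> = (\<Sum>i<k. \<omega> (Zs[i := D X (Zs ! i)]) p)"
    using sum.permute[OF \<sigma>, of "\<lambda>i. \<omega> (Zs[i := D X (Zs ! i)]) p"] by (simp add: o_def)
  finally show "cov_deriv D \<omega> (X # Ys) p = cov_deriv D \<omega> (X # Zs) p"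
    using inv[OF Ys Zs eq] len by (simp add: cov_deriv_Cons)
qed

text \<open>Rearrangements of the tail and the exchange of the first two entries together reach
  every rearrangement. If the heads \<open>X\<close> and \<open>Y\<close> differ, \<open>Y\<close>
  occurs behind \<open>X\<close>: it is moved to second place, exchanged with \<open>X\<close>, and
  the new tail is rearranged.\<close>

lemma symmetric_cov_derivI:
  assumes sym: "symmetric_tensor M (Suc k) \<omega>"
    and swap: "\<And>X Y Zs. X \<in> vector_fields M \<Longrightarrow> Y \<in> vector_fields M \<Longrightarrow> Zs \<in> vf_tuples M k \<Longrightarrow>
      cov_deriv D \<omega> (X # Y # Zs) = cov_deriv D \<omega> (Y # X # Zs)"
  shows "symmetric_tensor M (Suc (Suc k)) (cov_deriv D \<omega>)"
proof -
  have tensor: "cov_deriv D \<omega> \<in> covariant_tensors M (Suc (Suc k))"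
    using sym by (intro cov_deriv_in_covariant_tensors) (simp add: symmetric_tensor_def)
  show ?thesis
    unfolding symmetric_tensor_iff_mset[OF tensor]
  proof (intro ballI impI)
    fix Xs' Ys' assume X': "Xs' \<in> vf_tuples M (Suc (Suc k))" and Y': "Ys' \<in> vf_tuples M (Suc (Suc k))"
      and eq': "mset Xs' = mset Ys'"
    obtain X Xs where X: "Xs' = X # Xs" "X \<in> vector_fields M" "Xs \<in> vf_tuples M (Suc k)"
      using X' by (rule vf_tuples_SucE)
    obtain Y Ys where Y: "Ys' = Y # Ys" "Y \<in> vector_fields M" "Ys \<in> vf_tuples M (Suc k)"
      using Y' by (rule vf_tuples_SucE)
    have eq: "add_mset X (mset Xs) = add_mset Y (mset Ys)"
      using eq' X Y by simp
    show "cov_deriv D \<omega> Xs' = cov_deriv D \<omega> Ys'"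
    proof (cases "X = Y")
      case True
      then show ?thesis
        using eq X Y symmetric_cov_deriv_tail[OF sym X(2,3) Y(3)] by simp
    next
      case False
      \<comment> \<open>What remains of both argument lists once \<open>X\<close> and
        \<open>Y\<close> are taken out.\<close>
      define Zs where "Zs = remove1 Y Xs"
      have "Y \<in># add_mset X (mset Xs)"
        unfolding eq by simp
      then have YXs: "Y \<in> set Xs"
        using False by simp
      then have Xs_eq: "mset Xs = mset (Y # Zs)"
        by (simp add: Zs_def)
      have "add_mset Y (mset Ys) = add_mset Y (mset (X # Zs))"
        using eq Xs_eq by (simp add: add_mset_commute)
      then have Ys_eq: "mset (X # Zs) = mset Ys"
        by simp
      have Zs: "Zs \<in> vf_tuples M k"
        using X(3) YXs set_remove1_subset[of Y Xs] by (auto simp: Zs_def vf_tuples_def length_remove1)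
      have "cov_deriv D \<omega> (X # Xs) = cov_deriv D \<omega> (X # Y # Zs)"
        using X Y Zs Xs_eq by (intro symmetric_cov_deriv_tail[OF sym]) (auto simp: vf_tuples_Cons_iff)
      also have "\<dots> = cov_deriv D \<omega> (Y # X # Zs)"
        using X Y Zs by (intro swap)
      also have "\<dots> = cov_deriv D \<omega> (Y # Ys)"
        using X Y Zs Ys_eq by (intro symmetric_cov_deriv_tail[OF sym]) (auto simp: vf_tuples_Cons_iff)
      finally show ?thesis
        using X Y by simp
    qed
  qed
qed

text \<open>One-element lists with equal multisets are equal. Order 1 starts the induction, because
  \<open>symmetric_cov_derivI\<close> needs a tensor with at least one argument.\<close>

lemma symmetric_cov_deriv_pow_1:
  "f \<in> smooth_functions M \<Longrightarrow> symmetric_tensor M (Suc 0) (cov_deriv_pow D (Suc 0) f)"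
  by (subst symmetric_tensor_iff_mset[OF cov_deriv_pow_in_covariant_tensors])
     (auto simp: vf_tuples_def length_Suc_conv)

section \<open>Torsion, curvature and the symmetry of derivatives\<close>

lemma second_cov_deriv_swap:
  assumes "f \<in> smooth_functions M" "X \<in> vector_fields M" "Y \<in> vector_fields M"
  shows "cov_deriv_pow D 2 f [X, Y] p - cov_deriv_pow D 2 f [Y, X] p = - torsion D X Y p f"
  using Ricci_identity[OF cov_deriv_pow_in_covariant_tensors[OF assms(1), of 0] assms(2,3), of "[]" p]
  by (simp add: numeral_2_eq_2 vf_tuples_def cov_deriv_Cons)

lemma torsion_zero_iff:
  "torsion_zero M D \<longleftrightarrow> (\<forall>f\<in>smooth_functions M. symmetric_tensor M 2 (cov_deriv_pow D 2 f))"
proof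
  assume T: "torsion_zero M D"
  show "\<forall>f\<in>smooth_functions M. symmetric_tensor M 2 (cov_deriv_pow D 2 f)"
  proof
    fix f assume f: "f \<in> smooth_functions M"
    have "cov_deriv_pow D 2 f [X, Y] = cov_deriv_pow D 2 f [Y, X]"
      if "X \<in> vector_fields M" "Y \<in> vector_fields M" for X Y
      using second_cov_deriv_swap[OF f that] T that
      by (auto simp: fun_eq_iff torsion_zero_def vzero_def)
    then show "symmetric_tensor M 2 (cov_deriv_pow D 2 f)"
      using symmetric_cov_derivI[OF symmetric_cov_deriv_pow_1[OF f]]
      by (simp add: numeral_2_eq_2 vf_tuples_def)
  qed
next
  assume S: "\<forall>f\<in>smooth_functions M. symmetric_tensor M 2 (cov_deriv_pow D 2 f)"
  show "torsion_zero M D"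
    unfolding torsion_zero_def
  \<comment> \<open>It suffices to test the torsion field on every smooth \<open>f\<close> at every
    point.\<close>
  proof (intro ballI vf_eq_vzeroI torsion_in_vector_fields)
    fix X Y p f assume *: "X \<in> vector_fields M" "Y \<in> vector_fields M" "f \<in> smooth_functions M"
    have "cov_deriv_pow D 2 f [X, Y] = cov_deriv_pow D 2 f [Y, X]"
      using S * by (intro symmetric_tensor_swap[of 0]) (auto simp: numeral_2_eq_2 vf_tuples_def)
    then show "torsion D X Y p f = 0"
      using second_cov_deriv_swap[OF *(3,1,2), of p] by simp
  qed
qed

lemma torsion_free_Ricci_identity:
  assumes T: "torsion_zero M D" and \<omega>: "\<omega> \<in> covariant_tensors M k"
    and X: "X \<in> vector_fields M" and Y: "Y \<in> vector_fields M" and Zs: "Zs \<in> vf_tuples M k"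
  shows "cov_deriv D (cov_deriv D \<omega>) (X # Y # Zs) p - cov_deriv D (cov_deriv D \<omega>) (Y # X # Zs) p
       = - (\<Sum>i<k. \<omega> (Zs[i := curvature D X Y (Zs ! i)]) p)"
proof -
  \<comment> \<open>The direction is \<open>vzero\<close>, and \<nabla>\<omega> is linear in its
    direction.\<close>
  have "cov_deriv D \<omega> (torsion D X Y # Zs) p = 0"
    using tensor_vzero[OF cov_deriv_in_covariant_tensors[OF \<omega>], of "X # Zs" 0 p] T X Y Zs
    by (simp add: torsion_zero_def vf_tuples_Cons_iff)
  then show ?thesis
    by (simp add: Ricci_identity[OF \<omega> X Y Zs])
qed

lemma symmetric_cov_deriv_pow:
  assumes T: "torsion_zero M D" and R: "curvature_zero M D" and f: "f \<in> smooth_functions M"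
  shows "symmetric_tensor M (Suc n) (cov_deriv_pow D (Suc n) f)"
proof (induction n)
  case 0
  then show ?case
    using symmetric_cov_deriv_pow_1[OF f] .
next
  case (Suc n)
  \<comment> \<open>Two orders are in play: the induction hypothesis concerns order
    \<open>Suc n\<close>, whereas the Ricci identity is applied to the derivative of order
    \<open>n\<close>, two below the goal.\<close>
  note \<omega> = cov_deriv_pow_in_covariant_tensors[OF f, of n]
  have "cov_deriv D (cov_deriv_pow D (Suc n) f) (X # Y # Zs)
      = cov_deriv D (cov_deriv_pow D (Suc n) f) (Y # X # Zs)"
    if "X \<in> vector_fields M" "Y \<in> vector_fields M" and Zs: "Zs \<in> vf_tuples M n" for X Y Zs
  proof
    fix p
    have "(\<Sum>i<n. cov_deriv_pow D n f (Zs[i := curvature D X Y (Zs ! i)]) p) = 0"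
      using R that vf_tuples_nth[OF Zs]
      by (intro sum.neutral) (auto simp: curvature_zero_def tensor_vzero[OF \<omega> Zs])
    then show "cov_deriv D (cov_deriv_pow D (Suc n) f) (X # Y # Zs) p
        = cov_deriv D (cov_deriv_pow D (Suc n) f) (Y # X # Zs) p"
      using torsion_free_Ricci_identity[OF T \<omega> that, of p] by simp
  qed
  from symmetric_cov_derivI[OF Suc.IH this] show ?case
    by simp
qed

text \<open>Vanishing torsion removes the term \<nabla>df(T(X,Y),Z), so the defect of symmetry in
  the first two arguments is the curvature field applied to \<open>f\<close>, up to sign.\<close>

lemma curvature_zero_if_symmetric:
  assumes T: "torsion_zero M D"
    and S: "\<And>f. f \<in> smooth_functions M \<Longrightarrow> symmetric_tensor M 3 (cov_deriv_pow D 3 f)"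
  shows "curvature_zero M D"
  unfolding curvature_zero_def
proof (intro ballI vf_eq_vzeroI curvature_in_vector_fields)
  fix X Y Z p f
  assume *: "X \<in> vector_fields M" "Y \<in> vector_fields M" "Z \<in> vector_fields M" "f \<in> smooth_functions M"
  have Z: "[Z] \<in> vf_tuples M (Suc 0)"
    using * by (simp add: vf_tuples_def)
  have "cov_deriv_pow D 3 f [X, Y, Z] = cov_deriv_pow D 3 f [Y, X, Z]"
    using S * Z by (intro symmetric_tensor_swap[of "Suc 0"]) (auto simp: numeral_3_eq_3)
  then show "curvature D X Y Z p f = 0"
    using torsion_free_Ricci_identity[OF T cov_deriv_pow_in_covariant_tensors[OF *(4)] *(1,2) Z, of p]
    by (simp add: numeral_3_eq_3 cov_deriv_Cons)
qed

end

theorem theorem2p3: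
  fixes M :: "'a manifold" and D :: "'a vfield \<Rightarrow> 'a vfield \<Rightarrow> 'a vfield"
  assumes "smooth_manifold M" and "connection M D"
  shows "((\<forall>f\<in>smooth_functions M. symmetric_tensor M 2 (cov_deriv_pow D 2 f))
            \<longleftrightarrow> torsion_zero M D)
       \<and> ((\<forall>f\<in>smooth_functions M. symmetric_tensor M 2 (cov_deriv_pow D 2 f) \<and>
                                   symmetric_tensor M 3 (cov_deriv_pow D 3 f))
            \<longleftrightarrow> torsion_zero M D \<and> curvature_zero M D)
       \<and> (torsion_zero M D \<and> curvature_zero M D \<longrightarrow>
            (\<forall>n\<ge>2. \<forall>f\<in>smooth_functions M. symmetric_tensor M n (cov_deriv_pow D n f)))"
proof -
  interpret koszul_connection M D
    using assms by unfold_locales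
  have symm: "symmetric_tensor M n (cov_deriv_pow D n f)"
    if "torsion_zero M D" "curvature_zero M D" "n \<ge> 2" "f \<in> smooth_functions M" for n f
    \<comment> \<open>The lemma counts orders as \<open>Suc n\<close>, hence the instance
      \<open>n - 1\<close>.\<close>
    using symmetric_cov_deriv_pow[OF that(1,2,4), of "n - 1"] that(3) by simp
  have symm3: "symmetric_tensor M 3 (cov_deriv_pow D 3 f)"
    if "torsion_zero M D" "curvature_zero M D" "f \<in> smooth_functions M" for f
    using symm[of 3] that by simp
  show ?thesis
    using torsion_zero_iff curvature_zero_if_symmetric symm symm3 by blast
qed

end
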